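(* Let $p_0\ge 1$ be the number determined by $$\frac{\left(\sqrt5/6\right)^{2p_0-1}}{\sqrt{p_0}-\frac{1}{2\sqrt{p_0}}}=\left(1-\sqrt{3/\pi}\right)\pi ,$$ so that $p_0=1.8414$ to four decimal places. For real $p\ge 1$ define $$C(p):=\begin{cases}\sqrt{\dfrac{\pi}{3}}, & 1\le p\le p_0,\\[2mm] 1+\dfrac{1}{\sqrt{3\pi}}\,\dfrac{\left(\sqrt5/6\right)^{2p-1}}{\sqrt p-\frac{1}{2\sqrt p}}, & p>p_0.\end{cases}$$ Then for every real $p\ge 1$, $$\frac1\pi\int_{-\infty}^{\infty}\left(\frac{\sin^2 t}{t^2}\right)^p dt\ \le\ C(p)\,\frac{\sqrt{3/\pi}}{\sqrt p}\ \le\ \frac{1}{\sqrt p},$$ and the first two terms (the integral term and $C(p)\sqrt{3/\pi}/\sqrt p$) are equal if and only if $p=1$. Further, $$\lim_{p\to\infty}\ \left[\frac1\pi\int_{-\infty}^{\infty}\left(\frac{\sin^2 t}{t^2}\right)^p dt\Big/\frac{\sqrt{3/\pi}}{\sqrt p}\right]\ \le\ \lim_{p\to\infty}C(p)=1 .$$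
   Context: The exponent $p$ is a real number. The integrand $\sin^2 t/t^2$ is taken to be $1$ at $t=0$. *)

theory Defs
  imports "HOL-Analysis.Analysis"
begin

definition decay :: "real \<Rightarrow> real" where
  "decay p = (sqrt 5 / 6) powr (2 * p - 1) / (sqrt p - 1 / (2 * sqrt p))"

definition is_p0 :: "real \<Rightarrow> bool" where
  "is_p0 p \<longleftrightarrow> p \<ge> 1 \<and> decay p = (1 - sqrt (3 / pi)) * pi"

(* Existence and uniqueness of such a number are asserted in the theorem. *)
definition p0 :: real where
  "p0 = (THE p. is_p0 p)"

(* Only meant for p \<ge> 1. *)
definition C :: "real \<Rightarrow> real" where
  "C p = (if p \<le> p0 then sqrt (pi / 3) else 1 + 1 / sqrt (3 * pi) * decay p)"

definition sinc_sq :: "real \<Rightarrow> real" where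
  "sinc_sq t = (if t = 0 then 1 else (sin t)\<^sup>2 / t\<^sup>2)"

(* Lebesgue integral; the integrand is nonnegative and, since 0 powr p = 0,
   vanishes at the nonzero multiples of pi, as it should for p > 0. *)
definition ball_integral :: "real \<Rightarrow> real" where
  "ball_integral p = 1 / pi * (LINT t|lborel. sinc_sq t powr p)"

end

theory Submission
  imports Defs "HOL-Probability.Sinc_Integral" "HOL-Real_Asymp.Real_Asymp"
begin

text \<open>
  Write u = sinc_sq and I(p) for the normalised integral of u^p.  There are two regimes.

  For every p \<ge> 1 the integrand is at most exp (- p t^2 / 3) up to the abscissa 6 / sqrt 5 < pi and at
  most |t|^(-2 p) beyond it.  Integrating the two majorants gives exactly the bound with the second branch
  of C, with strict inequality (ball_integral_less_gaussian_bound); no more is needed for p > p0.  This bound exceeds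
  1 / sqrt p for p < p0, so below p0 another argument is required.

  For 1 < p \<le> 2, an interval that contains (1, p0], the claim is I(p) < 1 / sqrt p
  (ball_integral_less_inverse_sqrt), a case of Ball's integral inequality.  The difficulty is that
  I(1) = 1 is an equality, so the comparison near 1 is one of slopes.  The exact values I(1) = 1
  and I(2) = 2 / 3 follow from explicit primitives in terms of the sine integral.  Since I is convex, it is
  bounded by its chords, but the chord from 1 to 2 has slope -1/3, whereas 1 / sqrt p has slope -1/2
  at 1.  The missing steepness is provided by the lobes outside [-pi, pi]: they carry more than nine
  percent of the mass of u, but u \<le> 1 / 16 there, so that their contribution to I(1 + s) is reduced
  by the factor (1/16)^s (ball_integral_near_one).  This gives good bounds at the two intermediate
  exponents 17/16 and 5/4, and three chords then stay below three tangents of 1 / sqrt p.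

  The number p0 is located by evaluating the strictly decreasing function decay at 1.84135 and
  1.84145.  For the limit, the Gaussian bound gives the upper estimate, and the minorant 1 - t^2 / 3 of u
  gives, by dominated convergence after rescaling, the matching lower one
  (ball_integral_ratio_tendsto), so that both limits are 1.
\<close>

section \<open>Integrals of the second and fourth power of sin t / t\<close>

lemma sinc_sq_eq_sinc: "sinc_sq t = (sinc t)\<^sup>2"
  by (simp add: sinc_sq_def power_divide)

lemma isCont_sinc_sq: "isCont sinc_sq t"
proof -
  have "isCont (\<lambda>t. (sinc t)\<^sup>2) t" by (intro isCont_power isCont_sinc)
  then show ?thesis by (simp only: sinc_sq_eq_sinc[symmetric])
qed

lemma borel_measurable_sinc_sq [measurable]: "sinc_sq \<in> borel_measurable borel"
  by (intro borel_measurable_continuous_onI continuous_at_imp_continuous_on ballI isCont_sinc_sq)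

lemma sinc_sq_nonneg [simp]: "0 \<le> sinc_sq t"
  by (simp add: sinc_sq_def)

lemma sinc_sq_le_one: "sinc_sq t \<le> 1"
proof -
  have "(sin t)\<^sup>2 \<le> t\<^sup>2"
    using abs_sin_x_le_abs_x power_mono by (metis abs_ge_zero power2_abs)
  then show ?thesis by (simp add: sinc_sq_def divide_le_eq_1)
qed

lemma sinc_sq_minus [simp]: "sinc_sq (- t) = sinc_sq t"
  by (simp add: sinc_sq_def)

text \<open>
  Integration by parts turns (sin t)^2 / t^2 into sin (2 t) / t, whose primitive is Si (2 t).
  At 0 the quotient takes the default value 0 of division, which is also its limit.
\<close>

definition sinc_sq_primitive :: "real \<Rightarrow> real" where
  "sinc_sq_primitive t = Si (2 * t) - (sin t)\<^sup>2 / t"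

lemma DERIV_sinc_sq_primitive: assumes "t > 0" shows "(sinc_sq_primitive has_real_derivative sinc_sq t) (at t)"
proof -
  have "((\<lambda>t. Si (2 * t)) has_real_derivative sinc (2 * t) * 2) (at t)"
    by (rule DERIV_chain2[OF DERIV_Si]) (auto intro!: derivative_eq_intros)
  then have D: "(sinc_sq_primitive has_real_derivative sinc (2 * t) * 2 -
      ((2 * sin t * cos t) * t - (sin t)\<^sup>2) / (t * t)) (at t)"
    unfolding sinc_sq_primitive_def using assms by (auto intro!: derivative_eq_intros)
  have "sinc (2 * t) * 2 - ((2 * sin t * cos t) * t - (sin t)\<^sup>2) / (t * t) = sinc_sq t"
    using assms by (simp add: sinc_sq_def sin_double power2_eq_square diff_divide_distrib)
  with D show ?thesis by simp
qed

lemma tendsto_bounded_over_power_at_top: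
  fixes g :: "real \<Rightarrow> real"
  assumes g: "\<And>t. \<bar>g t\<bar> \<le> 1" and k: "k > 0"
  shows "((\<lambda>t. g t / t ^ k) \<longlongrightarrow> 0) at_top"
proof (rule tendsto_0_le[of "\<lambda>t. 1 / t ^ k"])
  show "((\<lambda>t::real. 1 / t ^ k) \<longlongrightarrow> 0) at_top"
    using k by (intro tendsto_divide_0[OF tendsto_const] filterlim_at_top_imp_at_infinity filterlim_pow_at_top filterlim_ident)
  have "norm (g t / t ^ k) \<le> norm (1 / t ^ k) * 1" for t
    unfolding norm_divide using g[of t] by (simp add: divide_right_mono)
  then show "\<forall>\<^sub>F t in at_top. norm (g t / t ^ k) \<le> norm (1 / t ^ k) * 1"
    by (intro always_eventually allI)
qed

lemma sinc_sq_primitive_at_top: "(sinc_sq_primitive \<longlongrightarrow> pi / 2) at_top"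
proof -
  have "filterlim (\<lambda>t::real. 2 * t) at_top at_top"
    by (simp add: filterlim_tendsto_pos_mult_at_top[OF tendsto_const] filterlim_ident)
  then have 1: "((\<lambda>t. Si (2 * t)) \<longlongrightarrow> pi / 2) at_top"
    by (rule filterlim_compose[OF Si_at_top])
  have 2: "((\<lambda>t::real. (sin t)\<^sup>2 / t ^ 1) \<longlongrightarrow> 0) at_top"
    by (intro tendsto_bounded_over_power_at_top) (auto simp: abs_square_le_1)
  show ?thesis using tendsto_diff[OF 1 2] by (simp add: sinc_sq_primitive_def[abs_def])
qed

lemma tendsto_sin_power_at_right_0:
  assumes "k < n" shows "((\<lambda>t::real. sin t ^ n / t ^ k) \<longlongrightarrow> 0) (at_right 0)"
proof -
  have "((\<lambda>t::real. (sin t / t) ^ k * sin t ^ (n - k)) \<longlongrightarrow> 1 ^ k * sin 0 ^ (n - k)) (at_right 0)"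
    by (intro tendsto_intros filterlim_mono[OF sinc_at_0 order_refl at_le]) auto
  moreover have "\<forall>\<^sub>F t::real in at_right 0. (sin t / t) ^ k * sin t ^ (n - k) = sin t ^ n / t ^ k"
  proof (intro always_eventually allI)
    fix t :: real
    have "sin t ^ n = sin t ^ k * sin t ^ (n - k)" using assms by (simp flip: power_add)
    then show "(sin t / t) ^ k * sin t ^ (n - k) = sin t ^ n / t ^ k" by (simp add: power_divide)
  qed
  ultimately show ?thesis using assms by (simp add: tendsto_cong power_0_left)
qed

lemma sinc_sq_primitive_at_0: "(sinc_sq_primitive \<longlongrightarrow> 0) (at_right 0)"
proof -
  have "isCont (\<lambda>t. Si (2 * t)) 0"
    by (intro continuous_within_compose3[OF isCont_Si]) auto
  then have "((\<lambda>t. Si (2 * t)) \<longlongrightarrow> 0) (at_right 0)"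
    by (auto simp: isCont_def Si_def zero_ereal_def[symmetric] intro: filterlim_mono[OF _ order_refl at_le])
  from tendsto_diff[OF this tendsto_sin_power_at_right_0[of 1 2]] show ?thesis
    by (simp add: sinc_sq_primitive_def[abs_def])
qed

text \<open>
  The fundamental theorem of calculus for an even nonnegative function outside an interval around 0.
  One-sided limits of the primitive replace its values, because the primitives of sinc_sq and its square have
  removable singularities at 0.
\<close>

lemma has_bochner_integral_even_FTC:
  fixes f F :: "real \<Rightarrow> real"
  assumes a: "0 \<le> a"
    and F: "\<And>t. t > a \<Longrightarrow> (F has_real_derivative f t) (at t)"
    and cont: "\<And>t. t > a \<Longrightarrow> isCont f t" and meas [measurable]: "f \<in> borel_measurable borel" and f: "\<And>t. 0 \<le> f t" "\<And>t. f (- t) = f t"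
    and A: "(F \<longlongrightarrow> A) (at_right a)" and B: "(F \<longlongrightarrow> B) at_top"
  shows "has_bochner_integral lborel (\<lambda>t. indicator {t. a \<le> \<bar>t\<bar>} t * f t) (2 * (B - A))"
proof -
  note FTC = interval_integral_FTC_nonneg[of "ereal a" \<infinity> F f A B, simplified]
  have lim: "((F \<circ> real_of_ereal) \<longlongrightarrow> A) (at_right (ereal a))" "((F \<circ> real_of_ereal) \<longlongrightarrow> B) (at_left \<infinity>)"
    using A B by (simp_all add: ereal_tendsto_simps)
  have "set_integrable lborel {a<..} f" "(LBINT x:{a<..}. f x) = B - A"
    using FTC F f cont lim by (auto simp: interval_lebesgue_integral_def)
  then have "has_bochner_integral lborel (\<lambda>t. indicator {a<..} t * f t) (B - A)"
    by (simp add: has_bochner_integral_iff set_integrable_def set_lebesgue_integral_def)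
  moreover have "AE t in lborel. indicator {a<..} t * f t = indicator {0..} t * (indicator {t. a \<le> \<bar>t\<bar>} t * f t)"
    by (rule AE_I[where N = "{a}"]) (use a in \<open>auto split: split_indicator\<close>)
  ultimately have "has_bochner_integral lborel (\<lambda>t. indicator {0..} t *\<^sub>R (indicator {t. a \<le> \<bar>t\<bar>} t * f t)) (B - A)"
    by (subst has_bochner_integral_cong_AE[symmetric]) auto
  from has_bochner_integral_even_function[OF this] f show ?thesis
    by (simp add: indicator_def)
qed

lemma sinc_sq_integral: "has_bochner_integral lborel sinc_sq pi"
  using has_bochner_integral_even_FTC[OF order_refl DERIV_sinc_sq_primitive isCont_sinc_sq borel_measurable_sinc_sq _ _ sinc_sq_primitive_at_0 sinc_sq_primitive_at_top]
  by simp

text \<open>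
  Two integrations by parts of (sin t)^4 / t^4 produce the second derivative of (sin t)^4, which is
  4 (sin (2 t))^2 - 4 (sin t)^2; hence the combination of sinc_sq_primitive at 2 t and at t.
\<close>

definition sinc_pow4_primitive :: "real \<Rightarrow> real" where
  "sinc_pow4_primitive t = 2 / 3 * (2 * sinc_sq_primitive (2 * t) - sinc_sq_primitive t) - 2 / 3 * ((sin t) ^ 3 * cos t / t\<^sup>2) - 1 / 3 * ((sin t) ^ 4 / t ^ 3)"

lemma DERIV_sinc_pow4_primitive: assumes "t > 0" shows "(sinc_pow4_primitive has_real_derivative (sinc_sq t)\<^sup>2) (at t)"
proof -
  have 1: "((\<lambda>t. sinc_sq_primitive (2 * t)) has_real_derivative sinc_sq (2 * t) * 2) (at t)"
    by (rule DERIV_chain2[OF DERIV_sinc_sq_primitive]) (use assms in \<open>auto intro!: derivative_eq_intros\<close>)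
  have 2: "((\<lambda>t. (sin t) ^ 3 * cos t / t\<^sup>2) has_real_derivative
      3 * (sin t)\<^sup>2 * (cos t)\<^sup>2 / t\<^sup>2 - 2 * (sin t) ^ 3 * cos t / t ^ 3 - (sin t) ^ 4 / t\<^sup>2) (at t)"
    using assms by (auto intro!: derivative_eq_intros simp: field_simps eval_nat_numeral)
  have 3: "((\<lambda>t. (sin t) ^ 4 / t ^ 3) has_real_derivative
      4 * (sin t) ^ 3 * cos t / t ^ 3 - 3 * (sin t) ^ 4 / t ^ 4) (at t)"
    using assms by (auto intro!: derivative_eq_intros simp: field_simps eval_nat_numeral)
  have D: "(sinc_pow4_primitive has_real_derivative 2 / 3 * (2 * (sinc_sq (2 * t) * 2) - sinc_sq t)
      - 2 / 3 * (3 * (sin t)\<^sup>2 * (cos t)\<^sup>2 / t\<^sup>2 - 2 * (sin t) ^ 3 * cos t / t ^ 3 - (sin t) ^ 4 / t\<^sup>2)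
      - 1 / 3 * (4 * (sin t) ^ 3 * cos t / t ^ 3 - 3 * (sin t) ^ 4 / t ^ 4)) (at t)" (is "(_ has_real_derivative ?D) _")
    unfolding sinc_pow4_primitive_def[abs_def]
    by (intro DERIV_diff DERIV_cmult 1 2 3 DERIV_sinc_sq_primitive assms)
  have s2: "sinc_sq (2 * t) = (sin t)\<^sup>2 * (cos t)\<^sup>2 / t\<^sup>2"
    using assms by (simp add: sinc_sq_def sin_double power_mult_distrib)
  have s1: "sinc_sq t = ((sin t) ^ 4 + (sin t)\<^sup>2 * (cos t)\<^sup>2) / t\<^sup>2"
    using assms by (simp add: sinc_sq_def cos_squared_eq algebra_simps flip: power_add)
  have "?D = (sin t) ^ 4 / t ^ 4"
    unfolding s2 s1 add_divide_distrib by (simp add: algebra_simps)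
  also have "\<dots> = (sinc_sq t)\<^sup>2"
    using assms by (simp add: sinc_sq_def power_divide flip: power_mult)
  finally show ?thesis using D by simp
qed

lemma sinc_pow4_primitive_at_top: "(sinc_pow4_primitive \<longlongrightarrow> pi / 3) at_top"
proof -
  have "filterlim (\<lambda>t::real. 2 * t) at_top at_top"
    by (simp add: filterlim_tendsto_pos_mult_at_top[OF tendsto_const] filterlim_ident)
  then have 1: "((\<lambda>t. sinc_sq_primitive (2 * t)) \<longlongrightarrow> pi / 2) at_top"
    by (rule filterlim_compose[OF sinc_sq_primitive_at_top])
  have le: "\<bar>sin t ^ n\<bar> \<le> 1" for t :: real and n by (simp add: power_abs power_le_one)
  have 2: "((\<lambda>t::real. (sin t) ^ 3 * cos t / t\<^sup>2) \<longlongrightarrow> 0) at_top"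
    by (intro tendsto_bounded_over_power_at_top) (auto simp: abs_mult intro!: mult_le_one le)
  have 3: "((\<lambda>t::real. (sin t) ^ 4 / t ^ 3) \<longlongrightarrow> 0) at_top"
    by (intro tendsto_bounded_over_power_at_top) (use le[of _ 4] in \<open>auto simp: power_le_one power_even_eq abs_square_le_1\<close>)
  have "(sinc_pow4_primitive \<longlongrightarrow> 2 / 3 * (2 * (pi / 2) - pi / 2) - 2 / 3 * 0 - 1 / 3 * 0) at_top"
    unfolding sinc_pow4_primitive_def[abs_def] by (intro tendsto_intros 1 2 3 sinc_sq_primitive_at_top)
  then show ?thesis by simp
qed

lemma sinc_pow4_primitive_at_0: "(sinc_pow4_primitive \<longlongrightarrow> 0) (at_right 0)"
proof -
  have "filterlim (\<lambda>t::real. 2 * t) (at_right 0) (at_right 0)" by real_asymp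
  then have 1: "((\<lambda>t. sinc_sq_primitive (2 * t)) \<longlongrightarrow> 0) (at_right 0)"
    by (rule filterlim_compose[OF sinc_sq_primitive_at_0])
  have "((\<lambda>t::real. sin t ^ 3 / t\<^sup>2 * cos t) \<longlongrightarrow> 0 * cos 0) (at_right 0)"
    by (intro tendsto_intros tendsto_sin_power_at_right_0) auto
  then have 2: "((\<lambda>t::real. sin t ^ 3 * cos t / t\<^sup>2) \<longlongrightarrow> 0) (at_right 0)"
    by simp
  have "(sinc_pow4_primitive \<longlongrightarrow> 2 / 3 * (2 * 0 - 0) - 2 / 3 * 0 - 1 / 3 * 0) (at_right 0)"
    unfolding sinc_pow4_primitive_def[abs_def]
    by (intro tendsto_intros 1 2 sinc_sq_primitive_at_0 tendsto_sin_power_at_right_0) auto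
  then show ?thesis by simp
qed

lemma sinc_sq_power2_integral: "has_bochner_integral lborel (\<lambda>t. (sinc_sq t)\<^sup>2) (2 * pi / 3)"
  using has_bochner_integral_even_FTC[OF order_refl DERIV_sinc_pow4_primitive isCont_power[OF isCont_sinc_sq] _ _ _ sinc_pow4_primitive_at_0 sinc_pow4_primitive_at_top]
  by simp

text \<open>
  The share of the total mass pi of sinc_sq that lies outside the central lobe; about 0.097.
\<close>

definition tail_mass :: real where
  "tail_mass = 2 * (pi / 2 - sinc_sq_primitive pi) / pi"

lemma sinc_sq_tail_integral:
  "has_bochner_integral lborel (\<lambda>t. indicator {t. pi \<le> \<bar>t\<bar>} t * sinc_sq t) (pi * tail_mass)"
proof -
  have "isCont sinc_sq_primitive pi" using DERIV_sinc_sq_primitive[of pi] by (simp add: DERIV_isCont)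
  then have lim: "(sinc_sq_primitive \<longlongrightarrow> sinc_sq_primitive pi) (at_right pi)"
    by (auto simp: isCont_def intro: filterlim_mono[OF _ order_refl at_le])
  have "has_bochner_integral lborel (\<lambda>t. indicator {t. pi \<le> \<bar>t\<bar>} t * sinc_sq t) (2 * (pi / 2 - sinc_sq_primitive pi))"
    by (rule has_bochner_integral_even_FTC[OF _ _ isCont_sinc_sq borel_measurable_sinc_sq _ _ lim sinc_sq_primitive_at_top])
      (auto intro: DERIV_sinc_sq_primitive less_trans[OF pi_gt_zero])
  then show ?thesis by (simp add: tail_mass_def)
qed

text \<open>
  The function H of the proof is an asymptotic primitive: its first terms come from integrating
  (1 - cos (2 t)) / (2 t^2) by parts twice, which leaves the error - 3 cos (2 t) / (4 t^4).  The extra term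
  1 / (4 t^3) makes the error 3 (1 + cos (2 t)) / (4 t^4) have a sign, so that H grows more slowly than
  sinc_sq_primitive on the whole tail.
\<close>

lemma tail_mass_ge: "1 / pi\<^sup>2 - 1 / pi ^ 4 \<le> tail_mass"
proof -
  define H :: "real \<Rightarrow> real" where
    "H t = - 1 / (2 * t) - sin (2 * t) / (4 * t\<^sup>2) + (1 + cos (2 * t)) / (4 * t ^ 3)" for t
  have DH: "(H has_real_derivative sinc_sq t - 3 * (1 + cos (2 * t)) / (4 * t ^ 4)) (at t)"
    if "t > 0" for t
  proof -
    have "(H has_real_derivative 1 / (2 * t\<^sup>2) - (cos (2 * t) / (2 * t\<^sup>2) - sin (2 * t) / (2 * t ^ 3))
       + (- sin (2 * t) / (2 * t ^ 3) - 3 * (1 + cos (2 * t)) / (4 * t ^ 4))) (at t)"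
      unfolding H_def[abs_def] using that
      by (auto intro!: derivative_eq_intros simp: field_simps eval_nat_numeral)
    moreover have "1 / (2 * t\<^sup>2) - cos (2 * t) / (2 * t\<^sup>2) = sinc_sq t"
      using that by (simp add: sinc_sq_def cos_double_sin flip: diff_divide_distrib)
    ultimately show ?thesis by (simp add: algebra_simps)
  qed
  have mono: "sinc_sq_primitive pi - H pi \<le> sinc_sq_primitive T - H T" if "T \<ge> pi" for T
  proof (rule DERIV_nonneg_imp_nondecreasing[OF that])
    fix t assume "pi \<le> t"
    then have t: "t > 0" using pi_gt_zero by linarith
    have "0 \<le> 3 * (1 + cos (2 * t)) / (4 * t ^ 4)"
      using cos_ge_minus_one[of "2 * t"]
      by (intro divide_nonneg_nonneg mult_nonneg_nonneg) (auto simp del: cos_ge_minus_one)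
    with DERIV_diff[OF DERIV_sinc_sq_primitive[OF t] DH[OF t]]
    show "\<exists>y. ((\<lambda>t. sinc_sq_primitive t - H t) has_real_derivative y) (at t) \<and> 0 \<le> y" by auto
  qed
  have "(H \<longlongrightarrow> 0) at_top"
    unfolding H_def[abs_def] by real_asymp
  from tendsto_diff[OF sinc_sq_primitive_at_top this]
  have "sinc_sq_primitive pi - H pi \<le> pi / 2 - 0"
    by (rule tendsto_lowerbound) (use mono in \<open>auto simp: eventually_at_top_linorder\<close>)
  moreover have "H pi = - 1 / (2 * pi) + 1 / (2 * pi ^ 3)"
    by (simp add: H_def)
  ultimately have "2 * (1 / (2 * pi) - 1 / (2 * pi ^ 3)) / pi \<le> tail_mass"
    unfolding tail_mass_def by (intro divide_right_mono) auto
  then show ?thesis by (simp add: field_simps eval_nat_numeral)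
qed

section \<open>Exponents between 1 and 2\<close>

lemma integrable_sinc_sq_powr:
  assumes "p \<ge> 1" shows "integrable lborel (\<lambda>t. sinc_sq t powr p)"
proof (rule Bochner_Integration.integrable_bound[of _ sinc_sq])
  show "integrable lborel sinc_sq" using sinc_sq_integral by (simp add: has_bochner_integral_iff)
  have "sinc_sq t powr p \<le> sinc_sq t powr 1" for t
    by (intro powr_mono' sinc_sq_nonneg sinc_sq_le_one assms)
  then show "AE t in lborel. norm (sinc_sq t powr p) \<le> norm (sinc_sq t)" by simp
qed simp

lemma ball_integral_1: "ball_integral 1 = 1"
  using sinc_sq_integral by (simp add: ball_integral_def has_bochner_integral_iff)

lemma ball_integral_2: "ball_integral 2 = 2 / 3"
proof -
  have "sinc_sq t powr 2 = (sinc_sq t)\<^sup>2" for t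
    by (cases "sinc_sq t = 0") (auto simp: powr_numeral less_le)
  then show ?thesis
    using sinc_sq_power2_integral by (simp add: ball_integral_def has_bochner_integral_iff)
qed

lemma powr_convex_exponent:
  fixes y p q \<theta> :: real
  assumes "0 \<le> y" "0 \<le> \<theta>" "\<theta> \<le> 1"
  shows "y powr ((1 - \<theta>) * p + \<theta> * q) \<le> (1 - \<theta>) * y powr p + \<theta> * y powr q"
proof (cases "y = 0")
  case False
  have "exp ((1 - \<theta>) *\<^sub>R (p * ln y) + \<theta> *\<^sub>R (q * ln y)) \<le> (1 - \<theta>) * exp (p * ln y) + \<theta> * exp (q * ln y)"
    by (rule convex_onD[OF exp_convex]) (use assms in auto)
  with False show ?thesis by (simp add: powr_def algebra_simps)
qed simp

text \<open>
  At each point the integrand is convex in the exponent.  A bound at finitely many exponents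
  therefore gives a piecewise linear bound in between.
\<close>

lemma ball_integral_convex:
  assumes "1 \<le> p" "1 \<le> q" "0 \<le> \<theta>" "\<theta> \<le> 1"
  shows "ball_integral ((1 - \<theta>) * p + \<theta> * q) \<le> (1 - \<theta>) * ball_integral p + \<theta> * ball_integral q"
proof -
  have ge: "1 \<le> (1 - \<theta>) * p + \<theta> * q"
    using convex_bound_le[of "-p" "-1" "-q" "1 - \<theta>" \<theta>] assms by simp
  have "(LINT t|lborel. sinc_sq t powr ((1 - \<theta>) * p + \<theta> * q))
      \<le> (LINT t|lborel. (1 - \<theta>) * sinc_sq t powr p + \<theta> * sinc_sq t powr q)"
    by (intro integral_mono integrable_sinc_sq_powr Bochner_Integration.integrable_add
        integrable_mult_right powr_convex_exponent assms ge sinc_sq_nonneg)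
  also have "\<dots> = (1 - \<theta>) * (LINT t|lborel. sinc_sq t powr p) + \<theta> * (LINT t|lborel. sinc_sq t powr q)"
    using assms by (simp add: integrable_sinc_sq_powr)
  finally show ?thesis
    by (simp add: ball_integral_def divide_simps)
qed

lemma ball_integral_le_chord:
  assumes "1 \<le> p" "p < q" "p \<le> r" "r \<le> q" "ball_integral p \<le> P" "ball_integral q \<le> Q"
  shows "ball_integral r * (q - p) \<le> (q - r) * P + (r - p) * Q"
proof -
  define \<theta> where "\<theta> = (r - p) / (q - p)"
  have \<theta>: "0 \<le> \<theta>" "\<theta> \<le> 1" "\<theta> * (q - p) = r - p" using assms by (auto simp: \<theta>_def)
  have r: "r = (1 - \<theta>) * p + \<theta> * q" using \<theta>(3) by (simp add: algebra_simps)
  have "ball_integral r \<le> (1 - \<theta>) * ball_integral p + \<theta> * ball_integral q"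
    unfolding r by (rule ball_integral_convex) (use assms \<theta> in auto)
  also have "\<dots> \<le> (1 - \<theta>) * P + \<theta> * Q"
    using assms \<theta> by (intro add_mono mult_left_mono) auto
  finally have "ball_integral r * (q - p) \<le> ((1 - \<theta>) * P + \<theta> * Q) * (q - p)"
    using assms by (intro mult_right_mono) auto
  also have "\<dots> = ((q - p) - \<theta> * (q - p)) * P + \<theta> * (q - p) * Q" by (simp add: algebra_simps)
  finally show ?thesis unfolding \<theta>(3) by simp
qed

text \<open>
  Beyond 4 the bound |sin t| \<le> 1 is enough.  Between pi and 4 the sine is still at most t - pi,
  and t - pi \<le> t / 4 there.
\<close>

lemma sinc_sq_tail_le:
  assumes "pi \<le> \<bar>t\<bar>" shows "sinc_sq t \<le> 1 / 16"
proof -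
  have "\<bar>sin x\<bar> \<le> x / 4" if "pi \<le> x" for x
  proof (cases "x \<le> 4")
    case True
    have "\<bar>sin x\<bar> = \<bar>sin (x - pi)\<bar>" by simp
    also have "\<dots> \<le> \<bar>x - pi\<bar>" by (rule abs_sin_x_le_abs_x)
    also have "\<dots> \<le> x / 4" using True that pi_approx by simp
    finally show ?thesis .
  next
    case False
    then show ?thesis using abs_sin_le_one[of x] by linarith
  qed
  from this[of "\<bar>t\<bar>"] assms have "\<bar>sin t\<bar> \<le> \<bar>t\<bar> / 4" by (simp add: abs_if split: if_splits)
  then have "(sin t)\<^sup>2 \<le> t\<^sup>2 / 16"
    using power_mono[of "\<bar>sin t\<bar>" "\<bar>t\<bar> / 4" 2] by (simp add: power_divide)
  moreover have "t \<noteq> 0" using assms pi_gt_zero by (auto simp del: pi_gt_zero)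
  ultimately show ?thesis by (simp add: sinc_sq_def divide_le_eq)
qed

text \<open>
  Concavity of the s-th power: y^s lies below its tangent at a; the inequality is multiplied by y.
  The right-hand side involves only the first and second powers of y, so its integral is known
  exactly when y is sinc_sq.
\<close>

lemma powr_le_tangent:
  fixes y a s :: real
  assumes "0 \<le> y" "0 < a" "0 \<le> s" "s \<le> 1"
  shows "y powr (1 + s) \<le> (1 - s) * a powr s * y + s * (a powr s / a) * y\<^sup>2"
proof (cases "y = 0")
  case False
  with assms have y: "y > 0" by simp
  have "(y / a) powr s \<le> (1 - s) + s * (y / a)"
    using powr_convex_exponent[of "y / a" s 0 1] assms y by simp
  then have "y * (a powr s * (y / a) powr s) \<le> y * (a powr s * ((1 - s) + s * (y / a)))"
    using y by (intro mult_left_mono) auto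
  then show ?thesis
    using y assms by (simp add: powr_add powr_divide power2_eq_square algebra_simps)
qed simp

text \<open>
  The central lobe carries large values of sinc_sq and the tail only values below 1 / 16.  Treating
  them separately, by the tangent at a on the lobe and by the factor (1/16)^s on the tail, is what
  captures the steep descent of the integral just after exponent 1: a single tangent for
  both would give no better than the log-convex interpolation (2/3)^s, which exceeds
  1 / sqrt (1 + s) for small s.
\<close>

lemma ball_integral_near_one:
  assumes s: "0 \<le> s" "s \<le> 1" and a: "0 < a"
  shows "ball_integral (1 + s) \<le> (1 - s) * a powr s + s * (a powr s / a) * (2 / 3)
           - ((1 - s) * a powr s - (1 / 16) powr s) * tail_mass"
proof -
  define K where "K = (1 - s) * a powr s"
  define L where "L = s * (a powr s / a)"
  define \<beta> where "\<beta> = (1 / 16 :: real) powr s"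
  have le: "sinc_sq t powr (1 + s)
      \<le> K * sinc_sq t + L * (sinc_sq t)\<^sup>2 - (K - \<beta>) * (indicator {t. pi \<le> \<bar>t\<bar>} t * sinc_sq t)" for t
  proof (cases "pi \<le> \<bar>t\<bar>")
    case True
    have "sinc_sq t powr (1 + s) = sinc_sq t * sinc_sq t powr s"
      by (simp add: powr_add)
    also have "\<dots> \<le> sinc_sq t * \<beta>"
      unfolding \<beta>_def using s sinc_sq_tail_le[OF True] by (intro mult_left_mono powr_mono2) auto
    also have "\<dots> \<le> sinc_sq t * \<beta> + L * (sinc_sq t)\<^sup>2"
      using s a by (simp add: L_def)
    finally show ?thesis using True by (simp add: algebra_simps)
  next
    case False
    then show ?thesis using powr_le_tangent[of "sinc_sq t" a s] s a by (simp add: K_def L_def)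
  qed
  have int: "has_bochner_integral lborel
      (\<lambda>t. K * sinc_sq t + L * (sinc_sq t)\<^sup>2 - (K - \<beta>) * (indicator {t. pi \<le> \<bar>t\<bar>} t * sinc_sq t))
      (K * pi + L * (2 * pi / 3) - (K - \<beta>) * (pi * tail_mass))"
    by (intro has_bochner_integral_diff has_bochner_integral_add has_bochner_integral_mult_right
        sinc_sq_integral sinc_sq_power2_integral sinc_sq_tail_integral)
  have "(LINT t|lborel. sinc_sq t powr (1 + s)) \<le> (LINT t|lborel.
      K * sinc_sq t + L * (sinc_sq t)\<^sup>2 - (K - \<beta>) * (indicator {t. pi \<le> \<bar>t\<bar>} t * sinc_sq t))"
    using s by (intro integral_mono integrable_sinc_sq_powr le integrable.intros[OF int]) auto
  also have "\<dots> = K * pi + L * (2 * pi / 3) - (K - \<beta>) * (pi * tail_mass)"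
    by (rule has_bochner_integral_integral_eq[OF int])
  also have "\<dots> = pi * (K + L * (2 / 3) - (K - \<beta>) * tail_mass)" by (simp add: algebra_simps)
  finally have "ball_integral (1 + s) \<le> K + L * (2 / 3) - (K - \<beta>) * tail_mass"
    by (simp add: ball_integral_def divide_le_eq mult.commute)
  then show ?thesis by (simp add: K_def L_def \<beta>_def)
qed

lemma tail_mass_ge_numeric: "tail_mass \<ge> 0.091"
proof -
  define z where "z = pi\<^sup>2"
  have "3.14\<^sup>2 \<le> z" "z \<le> 3.1416\<^sup>2"
    unfolding z_def using pi_approx by (auto intro!: power_mono)
  then have z: "9.83 \<le> z" "z \<le> 9.87" by (auto simp: power2_eq_square)
  have "0.091 * z * z \<le> 0.091 * 9.87 * z" using z by (intro mult_right_mono) auto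
  also have "\<dots> \<le> z - 1" using z by simp
  finally have "0.091 \<le> (z - 1) / (z * z)" using z by (simp add: field_simps)
  also have "\<dots> = 1 / pi\<^sup>2 - 1 / pi ^ 4"
    by (simp add: z_def field_simps eval_nat_numeral)
  finally show ?thesis using tail_mass_ge by simp
qed

lemma powr_inverse_bounds:
  fixes x c :: real
  assumes "n > 0" "0 < x" "0 < c"
  shows "x \<le> c ^ n \<Longrightarrow> x powr (1 / n) \<le> c" "c ^ n \<le> x \<Longrightarrow> c \<le> x powr (1 / n)"
proof -
  have c: "(c ^ n) powr (1 / n) = c"
    using assms by (simp add: powr_powr flip: powr_realpow)
  show "x \<le> c ^ n \<Longrightarrow> x powr (1 / n) \<le> c" "c ^ n \<le> x \<Longrightarrow> c \<le> x powr (1 / n)"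
    using powr_mono2[of "1 / n" x "c ^ n"] powr_mono2[of "1 / n" "c ^ n" x] assms c by auto
qed

text \<open>
  The choice a = 3 / 4 is close to the mean of sinc_sq over the central lobe with respect to the
  measure with density sinc_sq, which is the best place for the tangent.  The lower bound for
  (3/4)^s serves only to make the coefficient of the tail mass negative, so that a lower bound on
  that mass can be used.
\<close>

lemma ball_integral_near_one_numeric:
  assumes s: "0 \<le> s" "s \<le> 1"
    and A: "A\<^sub>0 \<le> (3 / 4) powr s" "(3 / 4) powr s \<le> A"
    and \<beta>: "(1 / 16) powr s \<le> \<beta>" and pos: "\<beta> \<le> (1 - s) * A\<^sub>0"
  shows "ball_integral (1 + s) \<le> A * (1 - s / 9 - 0.091 * (1 - s)) + 0.091 * \<beta>"
proof -
  define a where "a = (3 / 4 :: real) powr s"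
  define b where "b = (1 / 16 :: real) powr s"
  have "\<beta> \<le> (1 - s) * a"
    using pos mult_left_mono[OF A(1), of "1 - s"] s by (simp add: a_def)
  then have "0.091 * ((1 - s) * a - b) \<le> tail_mass * ((1 - s) * a - b)"
    using tail_mass_ge_numeric \<beta> by (intro mult_right_mono) (auto simp: b_def)
  moreover have "ball_integral (1 + s) \<le> (1 - s) * a + s * (a / (3 / 4)) * (2 / 3) - ((1 - s) * a - b) * tail_mass"
    unfolding a_def b_def by (rule ball_integral_near_one[OF s]) simp
  ultimately have "ball_integral (1 + s) \<le> (1 - s) * a + s * (a / (3 / 4)) * (2 / 3) - 0.091 * ((1 - s) * a - b)"
    by (simp only: mult.commute[of tail_mass])
  also have "\<dots> = a * (1 - s / 9 - 0.091 * (1 - s)) + 0.091 * b"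
    by (simp add: field_simps)
  also have "\<dots> \<le> A * (1 - s / 9 - 0.091 * (1 - s)) + 0.091 * \<beta>"
    using s A \<beta> by (intro add_mono mult_right_mono) (auto simp: a_def b_def)
  finally show ?thesis .
qed

text \<open>
  What matters is that the value lies below 31 / 32 = 0.96875, where the tangent of 1 / sqrt p at 1
  arrives.  The bound obtained, about 0.9681, is only slightly smaller, hence the four digits.
\<close>

lemma ball_integral_17_16: "ball_integral (17 / 16) < 0.9687"
proof -
  have "(3 / 4 :: real) powr (1 / 16) \<le> 0.9822" "0.98 \<le> (3 / 4 :: real) powr (1 / 16)"
    "(1 / 16 :: real) powr (1 / 16) \<le> 0.841"
    using powr_inverse_bounds(1)[of 16 "3 / 4" "0.9822"] powr_inverse_bounds(2)[of 16 "3 / 4" "0.98"]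
      powr_inverse_bounds(1)[of 16 "1 / 16" "0.841"]
    by (simp_all add: power_divide)
  from ball_integral_near_one_numeric[OF _ _ this(2,1,3)] show ?thesis by simp
qed

lemma ball_integral_5_4: "ball_integral (5 / 4) < 0.887"
proof -
  have "(3 / 4 :: real) powr (1 / 4) \<le> 0.9307" "0.9 \<le> (3 / 4 :: real) powr (1 / 4)"
    "(1 / 16 :: real) powr (1 / 4) \<le> 1 / 2"
    using powr_inverse_bounds(1)[of 4 "3 / 4" "0.9307"] powr_inverse_bounds(2)[of 4 "3 / 4" "0.9"]
      powr_inverse_bounds(1)[of 4 "1 / 16" "1 / 2"]
    by (simp_all add: power_divide)
  from ball_integral_near_one_numeric[OF _ _ this(2,1,3)] show ?thesis by simp
qed

text \<open>
  The tangent of the convex function 1 / sqrt p at p = c^2.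
\<close>

lemma inverse_sqrt_ge_tangent:
  fixes p c :: real
  assumes "0 < p" "0 < c"
  shows "3 / (2 * c) - p / (2 * c ^ 3) \<le> 1 / sqrt p"
proof -
  define r where "r = sqrt p"
  have r: "r > 0" "p = r\<^sup>2" using assms by (auto simp: r_def)
  have "0 \<le> (r - c)\<^sup>2 * (r + 2 * c)" using r assms by simp
  also have "\<dots> = 2 * c ^ 3 - r * (3 * c\<^sup>2 - r\<^sup>2)" by (simp add: algebra_simps eval_nat_numeral)
  finally have "(3 * c\<^sup>2 - r\<^sup>2) / (2 * c ^ 3) \<le> 1 / r"
    using r assms by (simp add: divide_simps mult.commute)
  moreover have "(3 * c\<^sup>2 - r\<^sup>2) / (2 * c ^ 3) = 3 / (2 * c) - r\<^sup>2 / (2 * c ^ 3)"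
    using assms by (simp add: diff_divide_distrib eval_nat_numeral)
  ultimately show ?thesis using r by (simp flip: r_def)
qed

text \<open>
  Three chords of the convex integral, over [1, 17/16], [17/16, 5/4] and [5/4, 2], each lie below
  a tangent of 1 / sqrt p.  The tangent points are c^2: the first must be 1, where equality holds, and
  c = 21/20 and c = 6/5 make the tangent nearly parallel to the chord.
\<close>

lemma ball_integral_less_inverse_sqrt:
  assumes "1 < p" "p \<le> 2" shows "ball_integral p < 1 / sqrt p"
proof -
  consider "p \<le> 17 / 16" | "17 / 16 \<le> p" "p \<le> 5 / 4" | "5 / 4 \<le> p" by linarith
  then show ?thesis
  proof cases
    case 1
    have "ball_integral p * (17 / 16 - 1) \<le> (17 / 16 - p) * 1 + (p - 1) * 0.9687"
      by (rule ball_integral_le_chord) (use ball_integral_17_16 ball_integral_1 1 assms in auto)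
    then have "ball_integral p < 3 / 2 - p / 2"
      using assms by (simp add: field_simps)
    also have "\<dots> = 3 / (2 * 1) - p / (2 * 1 ^ 3)" by simp
    also have "\<dots> \<le> 1 / sqrt p" by (rule inverse_sqrt_ge_tangent) (use assms in auto)
    finally show ?thesis .
  next
    case 2
    have "ball_integral p * (5 / 4 - 17 / 16) \<le> (5 / 4 - p) * 0.9687 + (p - 17 / 16) * 0.887"
      by (rule ball_integral_le_chord) (use ball_integral_17_16 ball_integral_5_4 2 assms in auto)
    then have "ball_integral p < 10 / 7 - 4000 / 9261 * p"
      using assms 2 by (simp add: field_simps)
    also have "\<dots> = 3 / (2 * (21 / 20)) - p / (2 * (21 / 20) ^ 3)" by (simp add: power_divide)
    also have "\<dots> \<le> 1 / sqrt p" by (rule inverse_sqrt_ge_tangent) (use assms in auto)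
    finally show ?thesis .
  next
    case 3
    have "ball_integral p * (2 - 5 / 4) \<le> (2 - p) * 0.887 + (p - 5 / 4) * (2 / 3)"
      by (rule ball_integral_le_chord) (use ball_integral_2 ball_integral_5_4 3 assms in auto)
    then have "ball_integral p < 5 / 4 - 125 / 432 * p"
      using assms 3 by (simp add: field_simps)
    also have "\<dots> = 3 / (2 * (6 / 5)) - p / (2 * (6 / 5) ^ 3)" by (simp add: power_divide)
    also have "\<dots> \<le> 1 / sqrt p" by (rule inverse_sqrt_ge_tangent) (use assms in auto)
    finally show ?thesis .
  qed
qed

section \<open>The Gaussian bound\<close>

text \<open>
  The function sin x / x * exp (x^2 / 6) equals 1 at 0 and decreases on (0, pi): up to a negative
  factor its derivative is sin x - x cos x - x^2 sin x / 3, which vanishes at 0 and has the nonnegative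
  derivative x / 3 * (sin x - x cos x).
\<close>

lemma sinc_sq_le_gaussian:
  assumes "\<bar>t\<bar> < pi" shows "sinc_sq t \<le> exp (- t\<^sup>2 / 3)"
proof -
  have sin_ge: "0 \<le> sin x - x * cos x" if "0 \<le> x" "x \<le> pi" for x :: real
  proof -
    have "sin 0 - 0 * cos 0 \<le> sin x - x * cos x"
    proof (rule DERIV_nonneg_imp_nondecreasing[OF that(1)])
      fix y assume y: "0 \<le> y" "y \<le> x"
      have "((\<lambda>x. sin x - x * cos x) has_real_derivative y * sin y) (at y)"
        by (auto intro!: derivative_eq_intros)
      moreover have "0 \<le> y * sin y" using y that by (intro mult_nonneg_nonneg sin_ge_zero) auto
      ultimately show "\<exists>D. ((\<lambda>x. sin x - x * cos x) has_real_derivative D) (at y) \<and> 0 \<le> D" by blast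
    qed
    then show ?thesis by simp
  qed
  have numerator_ge: "0 \<le> sin x - x * cos x - x\<^sup>2 * sin x / 3" if "0 \<le> x" "x \<le> pi" for x :: real
  proof -
    have "sin 0 - 0 * cos 0 - 0\<^sup>2 * sin 0 / 3 \<le> sin x - x * cos x - x\<^sup>2 * sin x / 3"
    proof (rule DERIV_nonneg_imp_nondecreasing[OF that(1)])
      fix y assume y: "0 \<le> y" "y \<le> x"
      have "((\<lambda>x. sin x - x * cos x - x\<^sup>2 * sin x / 3) has_real_derivative y / 3 * (sin y - y * cos y)) (at y)"
        by (auto intro!: derivative_eq_intros simp: field_simps power2_eq_square)
      moreover have "0 \<le> y / 3 * (sin y - y * cos y)"
        using y that sin_ge[of y] by (intro mult_nonneg_nonneg) auto
      ultimately show "\<exists>D. ((\<lambda>x. sin x - x * cos x - x\<^sup>2 * sin x / 3) has_real_derivative D) (at y) \<and> 0 \<le> D"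
        by blast
    qed
    then show ?thesis by simp
  qed
  define r where "r = \<bar>t\<bar>"
  have r: "0 \<le> r" "r < pi" using assms by (auto simp: r_def)
  define g where "g x = sinc x * exp (x\<^sup>2 / 6)" for x
  have "g r \<le> g 0"
  proof (rule DERIV_nonpos_imp_decreasing_open[OF r(1)])
    fix x assume x: "0 < x" "x < r"
    have "((\<lambda>x. sin x / x * exp (x\<^sup>2 / 6)) has_real_derivative
        - (exp (x\<^sup>2 / 6) / x\<^sup>2) * (sin x - x * cos x - x\<^sup>2 * sin x / 3)) (at x)"
      using x by (auto intro!: derivative_eq_intros simp: field_simps power2_eq_square)
    then have "(g has_real_derivative
        - (exp (x\<^sup>2 / 6) / x\<^sup>2) * (sin x - x * cos x - x\<^sup>2 * sin x / 3)) (at x)"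
      by (rule has_field_derivative_transform_within_open[of _ _ _ "{0<..}"]) (use x in \<open>auto simp: g_def\<close>)
    moreover have "- (exp (x\<^sup>2 / 6) / x\<^sup>2) * (sin x - x * cos x - x\<^sup>2 * sin x / 3) \<le> 0"
      using numerator_ge[of x] x r by (intro mult_nonpos_nonneg) auto
    ultimately show "\<exists>D. (g has_real_derivative D) (at x) \<and> D \<le> 0" by blast
  next
    show "continuous_on {0..r} g"
      unfolding g_def by (intro continuous_intros continuous_on_sinc) auto
  qed
  then have "sinc r \<le> exp (- (r\<^sup>2 / 6))"
    by (simp add: g_def exp_minus field_simps)
  moreover have "0 \<le> sinc r" using r by (simp add: sin_ge_zero)
  ultimately have "(sinc r)\<^sup>2 \<le> (exp (- (r\<^sup>2 / 6)))\<^sup>2" by (intro power_mono)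
  also have "\<dots> = exp (- t\<^sup>2 / 3)"
    by (simp add: r_def flip: exp_double)
  also have "(sinc r)\<^sup>2 = sinc_sq t"
    by (simp add: r_def sinc_sq_def power_divide abs_if)
  finally show ?thesis .
qed

lemma gaussian_integral:
  assumes "c > 0"
  shows "has_bochner_integral lborel (\<lambda>t. exp (- c * t\<^sup>2)) (sqrt (pi / c))"
proof -
  define \<sigma> where "\<sigma> = 1 / sqrt (2 * c)"
  have \<sigma>: "\<sigma> > 0" "\<sigma>\<^sup>2 = 1 / (2 * c)" using assms by (auto simp: \<sigma>_def power_divide)
  have "has_bochner_integral lborel (\<lambda>t. sqrt (pi / c) * normal_density 0 \<sigma> t) (sqrt (pi / c) * 1)"
    using \<sigma> by (intro has_bochner_integral_mult_right) (auto simp: has_bochner_integral_iff)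
  moreover have "sqrt (pi / c) * normal_density 0 \<sigma> t = exp (- c * t\<^sup>2)" for t
    using assms by (simp add: normal_density_def \<sigma>)
  ultimately show ?thesis by simp
qed

lemma inverse_power_tail_integral:
  fixes A q :: real
  assumes "A > 0" "q > 1"
  shows "has_bochner_integral lborel (\<lambda>t. indicator {t. A \<le> \<bar>t\<bar>} t * \<bar>t\<bar> powr - q) (2 * (A powr (1 - q) / (q - 1)))"
proof -
  define F where "F t = - (t powr (1 - q)) / (q - 1)" for t :: real
  have "has_bochner_integral lborel (\<lambda>t. indicator {t. A \<le> \<bar>t\<bar>} t * \<bar>t\<bar> powr - q) (2 * (0 - F A))"
  proof (rule has_bochner_integral_even_FTC)
    show "(F has_real_derivative \<bar>t\<bar> powr - q) (at t)" if "t > A" for t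
    proof -
      have "(F has_real_derivative - ((1 - q) * t powr (1 - q - 1)) / (q - 1)) (at t)"
        unfolding F_def[abs_def] using that assms by (auto intro!: derivative_eq_intros)
      also have "- ((1 - q) * t powr (1 - q - 1)) / (q - 1) = \<bar>t\<bar> powr - q"
        using that assms by (simp add: field_simps)
      finally show ?thesis .
    qed
    show "isCont (\<lambda>t. \<bar>t\<bar> powr - q) t" if "t > A" for t
      using that assms by (intro continuous_intros) auto
    show "(F \<longlongrightarrow> F A) (at_right A)"
      unfolding F_def using assms by (intro tendsto_intros) auto
    show "(F \<longlongrightarrow> 0) at_top"
    proof -
      have "((\<lambda>t::real. t powr (1 - q)) \<longlongrightarrow> 0) at_top"
        using assms by (intro tendsto_neg_powr filterlim_ident) auto
      from tendsto_divide[OF tendsto_minus[OF this] tendsto_const[of "q - 1"]] show ?thesis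
        using assms by (simp add: F_def[abs_def])
    qed
  qed (use assms in auto)
  then show ?thesis by (simp add: F_def)
qed

text \<open>
  The number sqrt 5 / 6 in the definition of decay is the reciprocal of the abscissa at which the
  majorant changes from Gaussian to power decay; the Gaussian one is available up to there because
  this abscissa is below pi.
\<close>

lemma split_point_bounds: "6 / sqrt 5 < pi" "0 < 6 / sqrt 5"
proof -
  have "2.2 < sqrt 5" by (rule real_less_rsqrt) (simp add: power2_eq_square)
  then have "6 / sqrt 5 < 6 / 2.2" by (intro divide_strict_left_mono) auto
  also have "\<dots> < pi" using pi_approx by simp
  finally show "6 / sqrt 5 < pi" .
qed simp

definition gaussian_bound :: "real \<Rightarrow> real" where
  "gaussian_bound p = (1 + 1 / sqrt (3 * pi) * decay p) * (sqrt (3 / pi) / sqrt p)"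

text \<open>
  The integrand is at most exp (- p t^2 / 3) for |t| < 6 / sqrt 5 and at most |t|^(-2 p) beyond.
  The Gaussian integrated over the whole line gives the leading term, the power gives the term with
  decay.  Strictness comes from the part of the Gaussian beyond 6 / sqrt 5 that is wasted.
\<close>

lemma ball_integral_less_gaussian_bound:
  assumes p: "p \<ge> 1"
  shows "ball_integral p < gaussian_bound p"
proof -
  define A where "A = 6 / sqrt 5"
  have A: "0 < A" "A < pi" using split_point_bounds by (auto simp: A_def)
  \<comment> \<open>The least value of the Gaussian on [A, A + 1], an interval of length 1: the waste is at least this.\<close>
  define \<epsilon> where "\<epsilon> = exp (- (p / 3) * (A + 1)\<^sup>2)"
  have ptw: "sinc_sq t powr p + \<epsilon> * indicator {A..A + 1} t
      \<le> exp (- (p / 3) * t\<^sup>2) + indicator {t. A \<le> \<bar>t\<bar>} t * \<bar>t\<bar> powr - (2 * p)" for t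
  proof (cases "A \<le> \<bar>t\<bar>")
    case True
    then have t: "t \<noteq> 0" using A by auto
    have "sinc_sq t \<le> 1 / t\<^sup>2"
      using t by (simp add: sinc_sq_def divide_right_mono abs_square_le_1)
    also have "\<dots> = \<bar>t\<bar> powr - 2"
      using t by (simp add: powr_minus powr_numeral inverse_eq_divide)
    finally have "sinc_sq t powr p \<le> (\<bar>t\<bar> powr - 2) powr p"
      using p by (intro powr_mono2) auto
    also have "\<dots> = \<bar>t\<bar> powr - (2 * p)" by (simp add: powr_powr)
    finally have "sinc_sq t powr p \<le> \<bar>t\<bar> powr - (2 * p)" .
    moreover have "\<epsilon> * indicator {A..A + 1} t \<le> exp (- (p / 3) * t\<^sup>2)"
    proof (cases "t \<in> {A..A + 1}")
      case True
      then have "t\<^sup>2 \<le> (A + 1)\<^sup>2" using A by (intro power_mono) auto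
      then have "p * t\<^sup>2 \<le> p * (A + 1)\<^sup>2" using p by (intro mult_left_mono) auto
      then show ?thesis by (simp add: \<epsilon>_def indicator_def)
    qed simp
    ultimately show ?thesis using True by simp
  next
    case False
    then have "sinc_sq t powr p \<le> exp (- t\<^sup>2 / 3) powr p"
      using p A by (intro powr_mono2 sinc_sq_le_gaussian) auto
    also have "\<dots> = exp (- (p / 3) * t\<^sup>2)"
      by (simp add: powr_def)
    finally show ?thesis using False by (auto split: split_indicator)
  qed
  have G: "has_bochner_integral lborel
      (\<lambda>t. exp (- (p / 3) * t\<^sup>2) + indicator {t. A \<le> \<bar>t\<bar>} t * \<bar>t\<bar> powr - (2 * p))
      (sqrt (pi / (p / 3)) + 2 * (A powr (1 - 2 * p) / (2 * p - 1)))"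
    using p A by (intro has_bochner_integral_add gaussian_integral inverse_power_tail_integral) auto
  have int: "integrable lborel (\<lambda>t. \<epsilon> * indicator {A..A + 1} t)"
    by simp
  have "(LINT t|lborel. sinc_sq t powr p) + \<epsilon>
      = (LINT t|lborel. sinc_sq t powr p + \<epsilon> * indicator {A..A + 1} t)"
    by (subst Bochner_Integration.integral_add[OF integrable_sinc_sq_powr[OF p] int]) simp
  also have "\<dots> \<le> (LINT t|lborel. exp (- (p / 3) * t\<^sup>2) + indicator {t. A \<le> \<bar>t\<bar>} t * \<bar>t\<bar> powr - (2 * p))"
    by (intro integral_mono Bochner_Integration.integrable_add integrable_sinc_sq_powr[OF p] int
        integrable.intros[OF G] ptw)
  also have "\<dots> = sqrt (pi / (p / 3)) + 2 * (A powr (1 - 2 * p) / (2 * p - 1))"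
    by (rule has_bochner_integral_integral_eq[OF G])
  finally have "(LINT t|lborel. sinc_sq t powr p) + \<epsilon> \<le> sqrt (pi / (p / 3)) + 2 * (A powr (1 - 2 * p) / (2 * p - 1))" .
  moreover have "\<epsilon> > 0" by (simp add: \<epsilon>_def)
  ultimately have "(LINT t|lborel. sinc_sq t powr p) < sqrt (pi / (p / 3)) + 2 * (A powr (1 - 2 * p) / (2 * p - 1))"
    by linarith
  then have "ball_integral p < (sqrt (pi / (p / 3)) + 2 * (A powr (1 - 2 * p) / (2 * p - 1))) / pi"
    unfolding ball_integral_def by (simp add: divide_strict_right_mono)
  also have "\<dots> = gaussian_bound p"
  proof -
    have 1: "sqrt (pi / (p / 3)) / pi = sqrt (3 / pi) / sqrt p"
    proof -
      have "sqrt (pi / (p / 3)) = sqrt ((3 / pi) * pi\<^sup>2 / p)"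
        by (simp add: power2_eq_square mult.commute)
      then show ?thesis by (simp add: real_sqrt_divide real_sqrt_mult)
    qed
    have "A powr (1 - 2 * p) = (1 / A) powr (2 * p - 1)"
      using A by (simp add: powr_divide powr_minus_divide[symmetric])
    also have "1 / A = sqrt 5 / 6" by (simp add: A_def)
    finally have 2: "A powr (1 - 2 * p) = (sqrt 5 / 6) powr (2 * p - 1)" .
    have "sqrt p - 1 / (2 * sqrt p) = (2 * p - 1) / (2 * sqrt p)"
      using p by (simp add: field_simps)
    then have 3: "decay p / sqrt p = 2 * (A powr (1 - 2 * p) / (2 * p - 1))"
      unfolding decay_def 2 using p by simp
    have "sqrt (3 / pi) / sqrt (3 * pi) = 1 / pi"
      by (simp add: real_sqrt_divide real_sqrt_mult)
    moreover have "(1 + 1 / a * d) * (b / c) = b / c + d / c * (b / a)" for a b c d :: real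
      by (simp add: algebra_simps)
    ultimately have "gaussian_bound p = sqrt (3 / pi) / sqrt p + decay p / sqrt p * (1 / pi)"
      unfolding gaussian_bound_def by metis
    then show ?thesis unfolding add_divide_distrib 1 3 by simp
  qed
  finally show ?thesis .
qed

section \<open>The function decay and the number p0\<close>

lemma decay_denominator_pos:
  assumes "p \<ge> 1" shows "0 < sqrt p - 1 / (2 * sqrt p)"
proof -
  have "1 / (2 * sqrt p) \<le> 1 / 2" "1 \<le> sqrt p" using assms by auto
  then show ?thesis by linarith
qed

lemma sqrt5_div_6_bounds: "0 < sqrt 5 / 6" "sqrt 5 / 6 < 1"
proof -
  have "sqrt 5 < 6" by (rule real_less_lsqrt) auto
  then show "sqrt 5 / 6 < 1" by simp
qed simp

lemma decay_strict_antimono: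
  assumes "1 \<le> p" "p < q" shows "decay q < decay p"
proof -
  have "sqrt p - 1 / (2 * sqrt p) < sqrt q - 1 / (2 * sqrt q)"
    using assms by (intro diff_strict_mono divide_strict_left_mono) auto
  moreover have "(sqrt 5 / 6) powr (2 * q - 1) < (sqrt 5 / 6) powr (2 * p - 1)"
    using assms sqrt5_div_6_bounds by (intro powr_less_mono') auto
  ultimately show ?thesis unfolding decay_def
    using decay_denominator_pos[OF assms(1)] by (intro frac_less2) auto
qed

lemma decay_antimono: "1 \<le> p \<Longrightarrow> p \<le> q \<Longrightarrow> decay q \<le> decay p"
  using decay_strict_antimono[of p q] by (cases "p = q") auto

lemma decay_tendsto_0: "(decay \<longlongrightarrow> 0) at_top"
proof -
  define a where "a = sqrt 5 / 6"
  have "((\<lambda>p. a powr (2 * p - 1) / (sqrt p - 1 / (2 * sqrt p))) \<longlongrightarrow> 0) at_top" if "0 < a" "a < 1"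
    using that by real_asymp
  then show ?thesis using sqrt5_div_6_bounds unfolding decay_def[abs_def] a_def by blast
qed

lemma isCont_decay: "p \<ge> 1 \<Longrightarrow> isCont decay p"
  unfolding decay_def[abs_def] using decay_denominator_pos[of p]
  by (intro continuous_intros) auto

text \<open>
  Since exp 2 = 7.389 is so close to 7.2, the inequality ln x \<le> x - 1 for x = 7.2 / exp 2 and its
  reciprocal is accurate enough.
\<close>

lemma ln_36_5_bounds: "1.9737 \<le> ln (36 / 5 :: real)" "ln (36 / 5) \<le> (1.9745 :: real)"
proof -
  define e where "e = (exp 1 :: real)"
  have e: "2.7182 \<le> e" "e \<le> 2.7183"
    using e_approx_32 unfolding e_def by (simp_all add: abs_if split: if_split_asm)
  have e2: "2.7182\<^sup>2 \<le> e\<^sup>2" "e\<^sup>2 \<le> 2.7183\<^sup>2"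
    using e by (auto intro!: power_mono)
  have "exp 2 = e\<^sup>2" unfolding e_def by (simp flip: exp_double)
  then have ln: "ln (36 / 5) = 2 + ln (36 / 5 / e\<^sup>2)"
    using e by (subst ln_div) (auto simp flip: \<open>exp 2 = e\<^sup>2\<close>)
  have "ln (36 / 5 / e\<^sup>2) \<le> 36 / 5 / e\<^sup>2 - 1"
    using e by (intro ln_le_minus_one) auto
  also have "\<dots> \<le> 36 / 5 / 2.7182\<^sup>2 - 1"
    using e e2 by (intro diff_right_mono divide_left_mono) auto
  finally show "ln (36 / 5) \<le> (1.9745 :: real)"
    unfolding ln by (simp add: power2_eq_square)
  have "- ln (36 / 5 / e\<^sup>2) = ln (e\<^sup>2 / (36 / 5))"
    using e by (simp add: ln_div)
  also have "\<dots> \<le> e\<^sup>2 / (36 / 5) - 1"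
    using e by (intro ln_le_minus_one) auto
  also have "\<dots> \<le> 2.7183\<^sup>2 / (36 / 5) - 1"
    using e2 by (intro diff_right_mono divide_right_mono) auto
  finally show "1.9737 \<le> ln (36 / 5 :: real)"
    unfolding ln by (simp add: power2_eq_square)
qed

text \<open>
  At p = 11 / 6, close to p0, the power of 5 / 36 has exponent 4 / 3 and can be computed by a cube root;
  the remaining exponential has an argument of size about 0.016.
\<close>

lemma decay_eq_exp:
  assumes "p \<ge> 1"
  shows "decay p = 2 * sqrt p / (2 * p - 1) * ((5 / 36) powr (4 / 3) * exp (- (p - 11 / 6) * ln (36 / 5)))"
proof -
  have "ln (sqrt 5 / 6) = ln 5 / 2 - ln 6"
    by (simp add: ln_div ln_sqrt)
  then have "ln (36 / 5 :: real) = - 2 * ln (sqrt 5 / 6)" "ln (5 / 36 :: real) = 2 * ln (sqrt 5 / 6)"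
    using ln_realpow[of 6 2] by (simp_all add: ln_div)
  then have "(sqrt 5 / 6) powr (2 * p - 1) = (5 / 36) powr (4 / 3) * exp (- (p - 11 / 6) * ln (36 / 5))"
    by (simp add: powr_def algebra_simps flip: exp_add)
  moreover have "sqrt p - 1 / (2 * sqrt p) = (2 * p - 1) / (2 * sqrt p)"
    using assms by (simp add: field_simps)
  ultimately show ?thesis unfolding decay_def by simp
qed

lemma powr_5_36_bounds: "0.0719266 \<le> (5 / 36 :: real) powr (4 / 3)" "(5 / 36 :: real) powr (4 / 3) \<le> 0.0719268"
proof -
  have "(5 / 36 :: real) powr (4 / 3) = ((5 / 36) ^ 4) powr (1 / 3)"
    by (simp add: powr_powr flip: powr_numeral)
  then show "0.0719266 \<le> (5 / 36 :: real) powr (4 / 3)" "(5 / 36 :: real) powr (4 / 3) \<le> 0.0719268"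
    using powr_inverse_bounds[of 3 "(5 / 36) ^ 4" "0.0719266"] powr_inverse_bounds[of 3 "(5 / 36) ^ 4" "0.0719268"]
    by (simp_all add: power_divide)
qed

lemma p0_level_bounds: "0.0716116 \<le> (1 - sqrt (3 / pi)) * pi" "(1 - sqrt (3 / pi)) * pi \<le> 0.0716127"
proof -
  have "sqrt (3 / pi) * pi = sqrt (3 * pi)"
    by (simp add: real_sqrt_divide real_sqrt_mult field_simps)
  then have eq: "(1 - sqrt (3 / pi)) * pi = pi - sqrt (3 * pi)"
    by (simp add: algebra_simps)
  have "sqrt (3 * pi) \<le> 3.069981"
    by (rule real_le_lsqrt) (use pi_approx in \<open>simp_all add: power2_eq_square\<close>)
  moreover have "3.06998 \<le> sqrt (3 * pi)"
    by (rule real_le_rsqrt) (use pi_approx in \<open>simp_all add: power2_eq_square\<close>)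
  ultimately show "0.0716116 \<le> (1 - sqrt (3 / pi)) * pi" "(1 - sqrt (3 / pi)) * pi \<le> 0.0716127"
    unfolding eq using pi_approx by simp_all
qed

text \<open>
  Both values differ from the level (1 - sqrt (3 / pi)) pi by about one part in ten thousand, so
  every factor is needed to about six digits and the exponential to second order.
\<close>

lemma decay_at_bracket:
  "(1 - sqrt (3 / pi)) * pi < decay 1.84135" "decay 1.84145 < (1 - sqrt (3 / pi)) * pi"
proof -
  define L where "L = ln (36 / 5 :: real)"
  note L = ln_36_5_bounds[folded L_def]
  define x where "x = 481 / 60000 * L"
  have x: "0 \<le> x" "x \<le> 0.01583" using L by (auto simp: x_def)
  have "0.98426 \<le> (1 - x / 4) ^ 4"
  proof -
    have "(1 - 0.01583 / 4) ^ 4 \<le> (1 - x / 4) ^ 4" using x by (intro power_mono) auto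
    then show ?thesis by (simp add: eval_nat_numeral)
  qed
  also have "\<dots> \<le> exp (- x / 4) ^ 4"
    using x exp_ge_add_one_self[of "- x / 4"] by (intro power_mono) auto
  also have "\<dots> = exp (- x)" by (simp flip: exp_of_nat_mult)
  finally have ex: "0.98426 \<le> exp (- x)" .
  have "1.35696 \<le> sqrt 1.84135" by (rule real_le_rsqrt) (simp add: power2_eq_square)
  then have "2 * 1.35696 / (2 * 1.84135 - 1) * (0.0719266 * 0.98426) \<le>
     2 * sqrt 1.84135 / (2 * 1.84135 - 1) * ((5 / 36) powr (4 / 3) * exp (- x))"
    using powr_5_36_bounds ex by (intro mult_mono divide_right_mono) auto
  also have "\<dots> = decay 1.84135"
    by (subst decay_eq_exp) (simp_all add: x_def L_def)
  finally show "(1 - sqrt (3 / pi)) * pi < decay 1.84135"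
    using p0_level_bounds by simp
  define y where "y = 487 / 60000 * L"
  have y: "0.016019 \<le> y" using L by (simp add: y_def)
  have "1.016147 \<le> 1 + 0.016019 + 0.016019\<^sup>2 / (2 :: real)" by (simp add: power2_eq_square)
  also have "\<dots> \<le> 1 + y + y\<^sup>2 / 2"
    using y by (intro add_mono divide_right_mono power_mono) auto
  also have "\<dots> \<le> exp y" using y by (intro exp_lower_Taylor_quadratic) auto
  finally have ey: "exp (- y) \<le> 1 / 1.016147"
    by (simp add: exp_minus field_simps)
  have "sqrt 1.84145 \<le> 1.35701" by (rule real_le_lsqrt) (simp_all add: power2_eq_square)
  have "decay 1.84145 = 2 * sqrt 1.84145 / (2 * 1.84145 - 1) * ((5 / 36) powr (4 / 3) * exp (- y))"
    by (subst decay_eq_exp) (simp_all add: y_def L_def)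
  also have "\<dots> \<le> 2 * 1.35701 / (2 * 1.84145 - 1) * (0.0719268 * (1 / 1.016147))"
    using powr_5_36_bounds ey \<open>sqrt 1.84145 \<le> 1.35701\<close> by (intro mult_mono divide_right_mono) auto
  finally show "decay 1.84145 < (1 - sqrt (3 / pi)) * pi"
    using p0_level_bounds by simp
qed

lemma is_p0_unique_exists: "\<exists>!p. is_p0 p"
proof -
  have "\<exists>p\<ge>1.84135. p \<le> 1.84145 \<and> decay p = (1 - sqrt (3 / pi)) * pi"
    by (rule IVT2) (use decay_at_bracket in \<open>auto intro!: isCont_decay\<close>)
  then obtain p where "1.84135 \<le> p" "decay p = (1 - sqrt (3 / pi)) * pi" by blast
  then have "is_p0 p" by (simp add: is_p0_def)
  moreover have "q = r" if "is_p0 q" "is_p0 r" for q r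
    using that decay_strict_antimono[of q r] decay_strict_antimono[of r q]
    by (cases q r rule: linorder_cases) (auto simp: is_p0_def)
  ultimately show ?thesis by blast
qed

lemma is_p0_p0: "is_p0 p0"
  unfolding p0_def by (rule theI'[OF is_p0_unique_exists])

lemma p0_bounds: "1.84135 < p0" "p0 < 1.84145"
proof -
  have p0: "1 \<le> p0" "decay p0 = (1 - sqrt (3 / pi)) * pi"
    using is_p0_p0 by (auto simp: is_p0_def)
  show "1.84135 < p0"
    using decay_antimono[of p0 "1.84135"] decay_at_bracket(1) p0 by linarith
  show "p0 < 1.84145"
    by (rule ccontr) (use decay_antimono[of "1.84145" p0] decay_at_bracket(2) p0 in simp)
qed

section \<open>The limit of large exponents\<close>

text \<open>
  The Taylor estimate cos x \<le> 1 - x^2 / 2 + x^4 / 24 at x = 2 t.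
\<close>

lemma sinc_sq_ge: "1 - t\<^sup>2 / 3 \<le> sinc_sq t"
proof (cases "t = 0")
  case False
  obtain y where "cos (2 * t) = (\<Sum>m<4. cos_coeff m * (2 * t) ^ m) + (cos (y + 1 / 2 * real 4 * pi) / fact 4) * (2 * t) ^ 4"
    using Maclaurin_cos_expansion[of "2 * t" 4] by blast
  then have "cos (2 * t) = 1 - 2 * t\<^sup>2 + 2 / 3 * (cos y * t ^ 4)"
    by (simp add: cos_coeff_def lessThan_nat_numeral fact_numeral power_mult_distrib)
  also have "\<dots> \<le> 1 - 2 * t\<^sup>2 + 2 / 3 * (1 * t ^ 4)"
    by (intro add_left_mono mult_left_mono mult_right_mono) auto
  finally have "t\<^sup>2 * (1 - t\<^sup>2 / 3) \<le> (sin t)\<^sup>2"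
    unfolding cos_double_sin by (simp add: algebra_simps flip: power_add)
  then show ?thesis using False by (simp add: sinc_sq_def pos_le_divide_eq mult.commute)
qed (simp add: sinc_sq_def)

lemma ball_integral_rescaled:
  assumes "p > 0"
  shows "pi * sqrt p * ball_integral p = (LINT x|lborel. sinc_sq (x / sqrt p) powr p)"
proof -
  have "(LINT t|lborel. sinc_sq t powr p) = \<bar>1 / sqrt p\<bar> *\<^sub>R (LINT x|lborel. sinc_sq (0 + 1 / sqrt p * x) powr p)"
    by (rule lborel_integral_real_affine) (use assms in auto)
  then show ?thesis using assms by (simp add: ball_integral_def)
qed

text \<open>
  Laplace's method: at scale 1 / sqrt p the minorant 1 - t^2 / 3 of sinc_sq turns into the Gaussian
  exp (- x^2 / 3), which also dominates it.  The truncation to x^2 \<le> p keeps the base of the power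
  positive.
\<close>

lemma truncated_integral_tendsto_gaussian:
  "((\<lambda>p. LINT x|lborel. indicator {x. x\<^sup>2 \<le> p} x * (1 - x\<^sup>2 / 3 / p) powr p) \<longlongrightarrow> sqrt (3 * pi)) at_top"
  (is "((\<lambda>p. LINT x|lborel. ?s p x) \<longlongrightarrow> _) _")
proof -
  have G: "has_bochner_integral lborel (\<lambda>x. exp (- (1 / 3) * x\<^sup>2)) (sqrt (pi / (1 / 3)))"
    by (rule gaussian_integral) simp
  have "((\<lambda>p. LINT x|lborel. ?s p x) \<longlongrightarrow> (LINT x|lborel. exp (- (1 / 3) * x\<^sup>2))) at_top"
  proof (rule integral_dominated_convergence_at_top)
    show "integrable lborel (\<lambda>x::real. exp (- (1 / 3) * x\<^sup>2))" using G by (rule integrable.intros)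
    show "AE x in lborel. ((\<lambda>p. ?s p x) \<longlongrightarrow> exp (- (1 / 3) * x\<^sup>2)) at_top"
    proof (intro AE_I2)
      fix x :: real
      have "((\<lambda>p. (1 + (- x\<^sup>2 / 3) / p) powr p) \<longlongrightarrow> exp (- x\<^sup>2 / 3)) at_top"
        by (rule tendsto_exp_limit_at_top)
      moreover have "\<forall>\<^sub>F p in at_top. (1 + (- x\<^sup>2 / 3) / p) powr p = ?s p x"
        using eventually_ge_at_top[of "x\<^sup>2"] by eventually_elim simp
      ultimately have "((\<lambda>p. ?s p x) \<longlongrightarrow> exp (- x\<^sup>2 / 3)) at_top"
        by (rule Lim_transform_eventually)
      then show "((\<lambda>p. ?s p x) \<longlongrightarrow> exp (- (1 / 3) * x\<^sup>2)) at_top"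
        by simp
    qed
    have "?s p x \<le> exp (- (1 / 3) * x\<^sup>2)" if "p > 0" for p x :: real
    proof (cases "x\<^sup>2 \<le> p")
      case True
      then have "0 \<le> 1 - x\<^sup>2 / 3 / p" using that by (simp add: field_simps) 
      moreover have "1 - x\<^sup>2 / 3 / p \<le> exp (- (x\<^sup>2 / 3 / p))"
        using exp_ge_add_one_self[of "- (x\<^sup>2 / 3 / p)"] by simp
      ultimately have "(1 - x\<^sup>2 / 3 / p) powr p \<le> exp (- (x\<^sup>2 / 3 / p)) powr p"
        using that by (intro powr_mono2) auto
      also have "\<dots> = exp (- (1 / 3) * x\<^sup>2)" using that by (simp add: powr_def)
      finally show ?thesis using True by simp
    qed simp
    then have "norm (?s p x) \<le> exp (- (1 / 3) * x\<^sup>2)" if "p > 0" for p x :: real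
      using that by (simp add: abs_mult)
    then show "\<forall>\<^sub>F p in at_top. AE x in lborel. norm (?s p x) \<le> exp (- (1 / 3) * x\<^sup>2)"
      by (intro eventually_mono[OF eventually_gt_at_top[of 0]] AE_I2)
  qed simp_all
  also have "(LINT x|lborel. exp (- (1 / 3) * x\<^sup>2)) = sqrt (3 * pi)"
    using has_bochner_integral_integral_eq[OF G] by (simp add: mult.commute)
  finally show ?thesis .
qed

lemma ball_integral_rescaled_ge:
  assumes "p \<ge> 1"
  shows "(LINT x|lborel. indicator {x. x\<^sup>2 \<le> p} x * (1 - x\<^sup>2 / 3 / p) powr p) \<le> pi * sqrt p * ball_integral p"
  unfolding ball_integral_rescaled[OF less_le_trans[OF zero_less_one assms]]
proof (rule integral_mono_AE')
  have "integrable lborel (\<lambda>x. sinc_sq (0 + 1 / sqrt p * x) powr p)"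
    using assms by (intro lborel_integrable_real_affine integrable_sinc_sq_powr) auto
  then show "integrable lborel (\<lambda>x. sinc_sq (x / sqrt p) powr p)" by simp
  have "indicator {x. x\<^sup>2 \<le> p} x * (1 - x\<^sup>2 / 3 / p) powr p \<le> sinc_sq (x / sqrt p) powr p" for x
  proof (cases "x\<^sup>2 \<le> p")
    case True
    have "0 \<le> 1 - x\<^sup>2 / 3 / p" using True assms by (simp add: field_simps)
    moreover have "1 - x\<^sup>2 / 3 / p \<le> sinc_sq (x / sqrt p)"
      using sinc_sq_ge[of "x / sqrt p"] assms by (simp add: power_divide mult.commute)
    ultimately show ?thesis using True assms by (simp add: powr_mono2)
  qed simp
  then show "AE x in lborel. indicator {x. x\<^sup>2 \<le> p} x * (1 - x\<^sup>2 / 3 / p) powr p \<le> sinc_sq (x / sqrt p) powr p"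
    by simp
qed simp

lemma ball_integral_ratio_tendsto:
  "((\<lambda>p. ball_integral p / (sqrt (3 / pi) / sqrt p)) \<longlongrightarrow> 1) at_top"
proof (rule tendsto_sandwich)
  have "sqrt (3 / pi) = sqrt (3 * pi) / pi"
    by (simp add: real_sqrt_divide real_sqrt_mult field_simps)
  then have ratio: "ball_integral p / (sqrt (3 / pi) / sqrt p) = pi * sqrt p * ball_integral p / sqrt (3 * pi)" for p
    by simp
  let ?I = "\<lambda>p. LINT x|lborel. indicator {x. x\<^sup>2 \<le> p} x * (1 - x\<^sup>2 / 3 / p) powr p"
  show "\<forall>\<^sub>F p in at_top. ?I p / sqrt (3 * pi) \<le> ball_integral p / (sqrt (3 / pi) / sqrt p)"
    using eventually_ge_at_top[of 1]
    by eventually_elim (unfold ratio, intro divide_right_mono ball_integral_rescaled_ge, auto)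
  show "((\<lambda>p. ?I p / sqrt (3 * pi)) \<longlongrightarrow> 1) at_top"
    using tendsto_divide[OF truncated_integral_tendsto_gaussian tendsto_const[of "sqrt (3 * pi)"]] by simp
  show "\<forall>\<^sub>F p in at_top. ball_integral p / (sqrt (3 / pi) / sqrt p) \<le> 1 + 1 / sqrt (3 * pi) * decay p"
    using eventually_ge_at_top[of 1]
  proof eventually_elim
    case (elim p)
    then have "0 < sqrt (3 / pi) / sqrt p" by simp
    from pos_divide_le_eq[OF this] show ?case
      using ball_integral_less_gaussian_bound[OF elim] unfolding gaussian_bound_def by simp
  qed
  show "((\<lambda>p. 1 + 1 / sqrt (3 * pi) * decay p) \<longlongrightarrow> 1) at_top"
    using tendsto_add[OF tendsto_const[of 1] tendsto_mult[OF tendsto_const[of "1 / sqrt (3 * pi)"] decay_tendsto_0]]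
    by simp
qed

lemma C_tendsto_1: "(C \<longlongrightarrow> 1) at_top"
proof -
  have "((\<lambda>p. 1 + 1 / sqrt (3 * pi) * decay p) \<longlongrightarrow> 1 + 1 / sqrt (3 * pi) * 0) at_top"
    by (intro tendsto_intros decay_tendsto_0)
  moreover have "\<forall>\<^sub>F p in at_top. 1 + 1 / sqrt (3 * pi) * decay p = C p"
    using eventually_gt_at_top[of p0] by eventually_elim (simp add: C_def)
  ultimately show ?thesis by (simp add: tendsto_cong)
qed

section \<open>The function C and the theorem\<close>

lemma C_bound_small:
  assumes "p \<le> p0" shows "C p * (sqrt (3 / pi) / sqrt p) = 1 / sqrt p"
  using assms by (simp add: C_def real_sqrt_divide)

lemma C_bound_large:
  assumes "p > p0" shows "C p * (sqrt (3 / pi) / sqrt p) = gaussian_bound p"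
  using assms by (simp add: C_def gaussian_bound_def)

text \<open>
  The two branches of C agree at p0, by the equation that defines p0, and decay decreases.
\<close>

lemma gaussian_bound_le:
  assumes "p > p0" shows "gaussian_bound p \<le> 1 / sqrt p"
proof -
  have p0: "1 \<le> p0" "decay p0 = (1 - sqrt (3 / pi)) * pi"
    using is_p0_p0 by (auto simp: is_p0_def)
  have "decay p \<le> (1 - sqrt (3 / pi)) * pi"
    using decay_strict_antimono[of p0 p] p0 assms by simp
  then have "(1 + 1 / sqrt (3 * pi) * decay p) * sqrt (3 / pi)
      \<le> (1 + 1 / sqrt (3 * pi) * ((1 - sqrt (3 / pi)) * pi)) * sqrt (3 / pi)"
    by (intro mult_right_mono add_left_mono mult_left_mono) auto
  also have "\<dots> = 1"
  proof -
    have one: "1 / sqrt (3 * pi) * pi * sqrt (3 / pi) = 1"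
      by (simp add: real_sqrt_divide real_sqrt_mult)
    have distrib: "(1 + 1 / b * ((1 - a) * c)) * a = a + (1 / b * c * a) * (1 - a)" for a b c :: real
      by (simp add: algebra_simps diff_divide_distrib)
    show ?thesis unfolding distrib one by simp
  qed
  finally show ?thesis
    using p0 assms unfolding gaussian_bound_def by (simp add: divide_right_mono)
qed

theorem theorem1:
  shows "(\<exists>!p. is_p0 p) \<and> \<bar>p0 - 1.8414\<bar> < 0.00005 \<and>
    (\<forall>p::real. p \<ge> 1 \<longrightarrow>
       integrable lborel (\<lambda>t. sinc_sq t powr p) \<and>
       ball_integral p \<le> C p * (sqrt (3 / pi) / sqrt p) \<and>
       C p * (sqrt (3 / pi) / sqrt p) \<le> 1 / sqrt p \<and>
       (ball_integral p = C p * (sqrt (3 / pi) / sqrt p) \<longleftrightarrow> p = 1)) \<and>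
    (\<exists>L M :: real.
       ((\<lambda>p. ball_integral p / (sqrt (3 / pi) / sqrt p)) \<longlongrightarrow> L) at_top \<and>
       (C \<longlongrightarrow> M) at_top \<and> L \<le> M \<and> M = 1)"
proof (intro conjI allI impI)
  show "\<exists>!p. is_p0 p" by (rule is_p0_unique_exists)
  show "\<bar>p0 - 1.8414\<bar> < 0.00005" unfolding abs_less_iff using p0_bounds by simp
  show "\<exists>L M :: real.
       ((\<lambda>p. ball_integral p / (sqrt (3 / pi) / sqrt p)) \<longlongrightarrow> L) at_top \<and>
       (C \<longlongrightarrow> M) at_top \<and> L \<le> M \<and> M = 1"
    using ball_integral_ratio_tendsto C_tendsto_1 by (intro exI[of _ 1]) auto
next
  fix p :: real assume p: "p \<ge> 1"
  show "integrable lborel (\<lambda>t. sinc_sq t powr p)" by (rule integrable_sinc_sq_powr[OF p])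
  show "C p * (sqrt (3 / pi) / sqrt p) \<le> 1 / sqrt p"
    using C_bound_small[of p] C_bound_large[of p] gaussian_bound_le[of p] by (cases "p \<le> p0") auto
  have strict: "ball_integral p < C p * (sqrt (3 / pi) / sqrt p)" if "p \<noteq> 1"
  proof (cases "p \<le> p0")
    case True
    then show ?thesis
      unfolding C_bound_small[OF True]
      using ball_integral_less_inverse_sqrt[of p] p that p0_bounds by simp
  next
    case False
    then show ?thesis using C_bound_large ball_integral_less_gaussian_bound[OF p] by simp
  qed
  have eq: "ball_integral 1 = C 1 * (sqrt (3 / pi) / sqrt 1)"
    using C_bound_small[of 1] p0_bounds ball_integral_1 by simp
  show "ball_integral p \<le> C p * (sqrt (3 / pi) / sqrt p)"
    using strict eq by (cases "p = 1") auto
  show "ball_integral p = C p * (sqrt (3 / pi) / sqrt p) \<longleftrightarrow> p = 1"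
    using strict eq by (cases "p = 1") auto
qed

end
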